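(* Let $H$ be a separable complex Hilbert space. If $T \in B(H)$ is a self-adjoint operator and $P_1 \leq P_2 \leq \cdots$ is any filtration of $H$ such that $\|[P_n,T]\| \to 0$, then: (1) $\sigma(P_nTP_n) \to \sigma(T)$ in the Hausdorff distance. (2) For every $n$, $\sigma(P_nTP_n) \subset^{\delta_n} \sigma(T)$, where $\delta_n = \|[T,P_n]\|$.
   Context: A filtration of $H$ is a sequence of finite rank orthogonal projections $P_n = P_n^* = P_n^2$ with $P_nH \subset P_{n+1}H$ for all $n$ and $\|P_n v - v\| \to 0$ for all $v \in H$. $[P,T] = PT - TP$. $P_nTP_n$ is regarded as an operator on the finite dimensional space $P_nH$ (i.e. as a matrix), and its spectrum is computed there. For $\Sigma,\Lambda \subset \mathbb{C}$ and $\delta \geq 0$, $\Sigma \subset^{\delta} \Lambda$ means that for every $\sigma \in \Sigma$ there is $\lambda \in \Lambda$ with $|\sigma - \lambda| \leq \delta$. For compact sets, $\Sigma_n \to \Sigma$ means $d_H(\Sigma_n,\Sigma) \to 0$, where $d_H(\Sigma,\Lambda) = \max\{\sup_{\sigma\in\Sigma} d(\sigma,\Lambda), \sup_{\lambda\in\Lambda} d(\lambda,\Sigma)\}$. *)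

theory Defs
  imports "HOL-Analysis.Analysis"
begin

text \<open>
  The inner product is antilinear in its first argument. The axioms of \<open>real_normed_vector\<close> that
  follow from those of the inner product are kept, so that norm, topology and completeness are
  the ones of the existing type classes.
\<close>

class complex_inner = real_normed_vector +
  fixes scaleC :: "complex \<Rightarrow> 'a \<Rightarrow> 'a" (infixr \<open>*\<^sub>C\<close> 75)
    and cinner :: "'a \<Rightarrow> 'a \<Rightarrow> complex"
  assumes scaleC_add_right: "a *\<^sub>C (x + y) = a *\<^sub>C x + a *\<^sub>C y"
    and scaleC_add_left: "(a + b) *\<^sub>C x = a *\<^sub>C x + b *\<^sub>C x"
    and scaleC_scaleC: "a *\<^sub>C (b *\<^sub>C x) = (a * b) *\<^sub>C x"
    and scaleR_scaleC: "r *\<^sub>R x = complex_of_real r *\<^sub>C x"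
    and cinner_commute: "cinner x y = cnj (cinner y x)"
    and cinner_add_right: "cinner x (y + z) = cinner x y + cinner x z"
    and cinner_scaleC_right: "cinner x (a *\<^sub>C y) = a * cinner x y"
    and cinner_ge_zero: "0 \<le> Re (cinner x x)"
    and cinner_eq_zero_iff: "cinner x x = 0 \<longleftrightarrow> x = 0"
    and norm_eq_sqrt_cinner: "norm x = sqrt (Re (cinner x x))"

class complex_hilbert = complex_inner + complete_space

instantiation complex :: complex_hilbert
begin

definition scaleC_complex :: "complex \<Rightarrow> complex \<Rightarrow> complex" where
  "scaleC_complex a x = a * x"

definition cinner_complex :: "complex \<Rightarrow> complex \<Rightarrow> complex" where
  "cinner_complex x y = cnj x * y"

instance
proof
  fix a b x y z :: complex and r :: real
  show "a *\<^sub>C (x + y) = a *\<^sub>C x + a *\<^sub>C y" "(a + b) *\<^sub>C x = a *\<^sub>C x + b *\<^sub>C x"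
    "a *\<^sub>C b *\<^sub>C x = (a * b) *\<^sub>C x"
    by (simp_all add: scaleC_complex_def distrib_left distrib_right)
  show "r *\<^sub>R x = complex_of_real r *\<^sub>C x"
    by (simp add: scaleC_complex_def scaleR_conv_of_real)
  show "cinner x y = cnj (cinner y x)" "cinner x (y + z) = cinner x y + cinner x z"
    "cinner x (a *\<^sub>C y) = a * cinner x y" "0 \<le> Re (cinner x x)" "cinner x x = 0 \<longleftrightarrow> x = 0"
    by (simp_all add: cinner_complex_def scaleC_complex_def distrib_left)
  show "norm x = sqrt (Re (cinner x x))"
    by (simp add: cinner_complex_def cmod_def power2_eq_square)
qed

end

global_interpretation complex_vector:
  vector_space "scaleC :: complex \<Rightarrow> 'a \<Rightarrow> 'a::complex_inner"
  defines cspan = complex_vector.span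
proof
  show "1 *\<^sub>C x = x" for x :: 'a
    using scaleR_scaleC[of 1 x] by simp
qed (simp_all add: scaleC_add_right scaleC_add_left scaleC_scaleC)

text \<open>
  The type \<open>'a \<Rightarrow>\<^sub>L 'a\<close> consists of the bounded real-linear operators. The algebra of bounded
  operators on the complex Hilbert space \<open>'a\<close> consists of those that are \<open>complex_linear\<close>; the
  operator norm is the same for both scalar fields.
\<close>

definition complex_linear :: "('a::complex_inner \<Rightarrow>\<^sub>L 'a) \<Rightarrow> bool" where
  "complex_linear A \<longleftrightarrow> (\<forall>c x. A (c *\<^sub>C x) = c *\<^sub>C A x)"

definition is_adjoint :: "('a::complex_inner \<Rightarrow>\<^sub>L 'a) \<Rightarrow> ('a \<Rightarrow>\<^sub>L 'a) \<Rightarrow> bool" where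
  "is_adjoint B A \<longleftrightarrow> (\<forall>x y. cinner (B x) y = cinner x (A y))"

definition self_adjoint :: "('a::complex_inner \<Rightarrow>\<^sub>L 'a) \<Rightarrow> bool" where
  "self_adjoint A \<longleftrightarrow> is_adjoint A A"

definition orthogonal_projection :: "('a::complex_inner \<Rightarrow>\<^sub>L 'a) \<Rightarrow> bool" where
  "orthogonal_projection P \<longleftrightarrow> complex_linear P \<and> self_adjoint P \<and> P o\<^sub>L P = P"

definition finite_rank :: "('a::complex_inner \<Rightarrow>\<^sub>L 'a) \<Rightarrow> bool" where
  "finite_rank A \<longleftrightarrow> (\<exists>B. finite B \<and> range (blinfun_apply A) = cspan B)"

definition filtration :: "(nat \<Rightarrow> 'a::complex_inner \<Rightarrow>\<^sub>L 'a) \<Rightarrow> bool" where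
  "filtration P \<longleftrightarrow>
     (\<forall>n. orthogonal_projection (P n) \<and> finite_rank (P n)) \<and>
     (\<forall>n. range (blinfun_apply (P n)) \<subseteq> range (blinfun_apply (P (Suc n)))) \<and>
     (\<forall>v. (\<lambda>n. norm (P n v - v)) \<longlonglongrightarrow> 0)"

definition commutator :: "('a::complex_inner \<Rightarrow>\<^sub>L 'a) \<Rightarrow> ('a \<Rightarrow>\<^sub>L 'a) \<Rightarrow> ('a \<Rightarrow>\<^sub>L 'a)" where
  "commutator A B = (A o\<^sub>L B) - (B o\<^sub>L A)"

definition bounded_operator_on :: "'a::complex_inner set \<Rightarrow> ('a \<Rightarrow> 'a) \<Rightarrow> bool" where
  "bounded_operator_on V G \<longleftrightarrow>
     G ` V \<subseteq> V \<and>
     (\<forall>x\<in>V. \<forall>y\<in>V. G (x + y) = G x + G y) \<and>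
     (\<forall>c. \<forall>x\<in>V. G (c *\<^sub>C x) = c *\<^sub>C G x) \<and>
     (\<exists>K. \<forall>x\<in>V. norm (G x) \<le> K * norm x)"

text \<open>
  For a closed subspace \<open>V\<close> with \<open>A V \<subseteq> V\<close>, the spectrum of \<open>A\<close> regarded as an operator on \<open>V\<close>:
  the \<open>\<mu>\<close> for which \<open>A - \<mu>\<close> has no inverse among the bounded operators on \<open>V\<close>.
\<close>

definition spectrum_on :: "'a::complex_inner set \<Rightarrow> ('a \<Rightarrow>\<^sub>L 'a) \<Rightarrow> complex set" where
  "spectrum_on V A =
     {\<mu>. \<not> (\<exists>G. bounded_operator_on V G \<and>
              (\<forall>x\<in>V. G (A x - \<mu> *\<^sub>C x) = x \<and> A (G x) - \<mu> *\<^sub>C G x = x))}"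

definition spectrum :: "('a::complex_inner \<Rightarrow>\<^sub>L 'a) \<Rightarrow> complex set" where
  "spectrum A = spectrum_on UNIV A"

definition compression_spectrum ::
    "('a::complex_inner \<Rightarrow>\<^sub>L 'a) \<Rightarrow> ('a \<Rightarrow>\<^sub>L 'a) \<Rightarrow> complex set" where
  "compression_spectrum P A = spectrum_on (range (blinfun_apply P)) (P o\<^sub>L A o\<^sub>L P)"

text \<open>
  The values are extended reals so that \<open>d(\<sigma>, \<emptyset>) = \<infinity>\<close>: the spectrum of an operator on the zero
  space is empty. A supremum over the empty set is \<open>0\<close>.
\<close>

definition hausdorff_distance :: "complex set \<Rightarrow> complex set \<Rightarrow> ennreal" where
  "hausdorff_distance S L =
     max (SUP \<sigma>\<in>S. INF \<mu>\<in>L. ennreal (cmod (\<sigma> - \<mu>)))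
         (SUP \<mu>\<in>L. INF \<sigma>\<in>S. ennreal (cmod (\<mu> - \<sigma>)))"

definition subset_within :: "real \<Rightarrow> complex set \<Rightarrow> complex set \<Rightarrow> bool" where
  "subset_within \<delta> S L \<longleftrightarrow> (\<forall>\<sigma>\<in>S. \<exists>\<mu>\<in>L. cmod (\<sigma> - \<mu>) \<le> \<delta>)"

end

theory Submission
  imports Defs
begin

text \<open>
  The spectrum of a self-adjoint operator consists of its approximate eigenvalues, and a real
  \<open>l\<close> with \<open>\<parallel>(A - l)x\<parallel> \<le> \<delta> \<parallel>x\<parallel>\<close> for some \<open>x \<noteq> 0\<close> lies within \<open>\<delta>\<close> of the spectrum. If \<open>P x = x\<close> then
  \<open>T x - P T P x = [T, P] x\<close>, so approximate eigenvectors of the compression are ones of \<open>T\<close> up to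
  \<open>\<parallel>[T, P]\<parallel>\<close>. Conversely, if \<open>x\<close> is an approximate eigenvector of \<open>T\<close>, then \<open>P\<^sub>n x\<close> is eventually one
  of the compression; compactness of the spectrum makes this uniform.
\<close>

section \<open>Inner product identities and orthogonal projections\<close>

lemma cinner_add_left: "cinner (x + y) z = cinner x z + cinner y (z :: 'a::complex_inner)"
  by (metis cinner_add_right cinner_commute complex_cnj_add)

lemma cinner_scaleC_left: "cinner (a *\<^sub>C x) y = cnj a * cinner x (y :: 'a::complex_inner)"
  by (metis cinner_scaleC_right cinner_commute complex_cnj_mult)

lemma norm_power2_cinner: "(norm x)\<^sup>2 = Re (cinner x (x :: 'a::complex_inner))"
  by (simp add: norm_eq_sqrt_cinner cinner_ge_zero)

lemma cinner_self: "cinner x x = complex_of_real ((norm (x :: 'a::complex_inner))\<^sup>2)"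
proof -
  have "Im (cinner x x) = - Im (cinner x x)"
    using arg_cong[OF cinner_commute[of x x], of Im] by simp
  then show ?thesis
    by (simp add: complex_eq_iff norm_power2_cinner)
qed

lemma norm_scaleC: "norm (a *\<^sub>C x) = cmod a * norm (x :: 'a::complex_inner)"
proof -
  have "cinner (a *\<^sub>C x) (a *\<^sub>C x) = (a * cnj a) * cinner x x"
    by (simp add: cinner_scaleC_left cinner_scaleC_right)
  also have "\<dots> = complex_of_real ((cmod a * norm x)\<^sup>2)"
    by (simp only: complex_norm_square[symmetric] cinner_self of_real_mult power_mult_distrib)
  finally have "cinner (a *\<^sub>C x) (a *\<^sub>C x) = complex_of_real ((cmod a * norm x)\<^sup>2)" .
  then have "(norm (a *\<^sub>C x))\<^sup>2 = (cmod a * norm x)\<^sup>2"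
    by (simp add: norm_power2_cinner)
  then show ?thesis
    by simp
qed

lemma norm_power2_add_cinner:
  "(norm (x + y))\<^sup>2 = (norm x)\<^sup>2 + 2 * Re (cinner x y) + (norm (y :: 'a::complex_inner))\<^sup>2"
proof -
  have "Re (cinner y x) = Re (cinner x y)"
    using arg_cong[OF cinner_commute[of y x], of Re] by simp
  then show ?thesis
    by (simp add: norm_power2_cinner cinner_add_left cinner_add_right)
qed

text \<open>This expansion in \<open>a\<close> drives both the contraction estimate of
  \<open>shift_surj\<close> and the positivity argument for the quadratic form of
  \<open>B\<close>.\<close>

lemma norm_power2_diff_scaleR:
  "(norm (x - a *\<^sub>R y))\<^sup>2
     = (norm x)\<^sup>2 - 2 * a * Re (cinner x y) + a\<^sup>2 * (norm (y :: 'a::complex_inner))\<^sup>2"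
proof -
  have "Re (cinner x ((- a) *\<^sub>R y)) = - a * Re (cinner x y)"
    unfolding scaleR_scaleC cinner_scaleC_right by simp
  with norm_power2_add_cinner[of x "(- a) *\<^sub>R y"] show ?thesis
    by (simp add: power_mult_distrib)
qed

text \<open>Pythagoras: \<open>P x\<close> and \<open>x - P x\<close> are orthogonal.\<close>

lemma orthogonal_projection_norm_le:
  assumes "orthogonal_projection P"
  shows "norm (P x) \<le> norm x"
proof -
  have PP: "P (P y) = P y" for y
    using assms unfolding orthogonal_projection_def by (metis blinfun_apply_blinfun_compose)
  have "cinner (P x) (x - P x) = cinner x (P x - P (P x))"
    using assms unfolding orthogonal_projection_def self_adjoint_def is_adjoint_def
    by (metis blinfun.diff_right)
  also have "\<dots> = 0"
    using cinner_scaleC_right[of x 0 0] by (simp add: PP)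
  finally have "(norm x)\<^sup>2 = (norm (P x))\<^sup>2 + (norm (x - P x))\<^sup>2"
    using norm_power2_add_cinner[of "P x" "x - P x"] by simp
  then show ?thesis
    by (metis le_add_same_cancel1 norm_ge_zero power2_le_imp_le zero_le_power2)
qed

text \<open>Idempotence gives this. As a set of fixed points, the range is easily seen to be a
  closed subspace.\<close>

lemma orthogonal_projection_range:
  assumes "orthogonal_projection P"
  shows "range (blinfun_apply P) = {x. P x = x}"
proof -
  have "P (P y) = P y" for y
    using assms unfolding orthogonal_projection_def by (metis blinfun_apply_blinfun_compose)
  then show ?thesis
    by (auto intro: range_eqI[OF sym])
qed

section \<open>The spectrum of a self-adjoint operator on an invariant closed subspace\<close>

definition shift :: "('a::complex_inner \<Rightarrow>\<^sub>L 'a) \<Rightarrow> complex \<Rightarrow> 'a \<Rightarrow> 'a" where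
  "shift A \<mu> x = A x - \<mu> *\<^sub>C x"

text \<open>
  An invariant closed subspace \<open>V\<close> covers both \<open>T\<close> itself and its compressions.
\<close>

locale self_adjoint_on =
  fixes V :: "'a::complex_hilbert set" and A :: "'a \<Rightarrow>\<^sub>L 'a"
  assumes linear: "complex_linear A"
    and sa: "self_adjoint A"
    and invariant: "\<And>x. x \<in> V \<Longrightarrow> A x \<in> V"
    and closed: "closed V"
    and subspace: "complex_vector.subspace V"
begin

lemma shift_add: "shift A \<mu> (x + y) = shift A \<mu> x + shift A \<mu> y"
  by (simp add: shift_def blinfun.add_right scaleC_add_right)

lemma shift_scaleC: "shift A \<mu> (c *\<^sub>C x) = c *\<^sub>C shift A \<mu> x"
  using linear
  by (simp add: shift_def complex_linear_def complex_vector.scale_right_diff_distrib mult.commute)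

lemma shift_diff: "shift A \<mu> (x - y) = shift A \<mu> x - shift A \<mu> y"
  by (simp add: shift_def blinfun.diff_right complex_vector.scale_right_diff_distrib)

lemma shift_scaleR: "shift A \<mu> (r *\<^sub>R x) = r *\<^sub>R shift A \<mu> x"
  by (simp add: scaleR_scaleC shift_scaleC)

text \<open>Together with \<open>cinner_shift\<close> this makes every shift a normal operator, also
  for non-real \<open>\<mu>\<close>.\<close>

lemma shift_shift: "shift A \<mu> (shift A \<nu> x) = shift A \<nu> (shift A \<mu> x)"
proof -
  have "A (c *\<^sub>C x) = c *\<^sub>C A x" for c x
    using linear by (simp add: complex_linear_def)
  then show ?thesis
    by (simp add: shift_def blinfun.diff_right complex_vector.scale_right_diff_distrib
        mult.commute)
qed

lemma shift_in: "x \<in> V \<Longrightarrow> shift A \<mu> x \<in> V"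
  unfolding shift_def
  using subspace invariant
  by (simp add: complex_vector.subspace_diff complex_vector.subspace_scale)

lemma scaleR_in: "x \<in> V \<Longrightarrow> r *\<^sub>R x \<in> V"
  unfolding scaleR_scaleC using subspace by (rule complex_vector.subspace_scale)

lemma norm_shift_le: "norm (shift A \<mu> x) \<le> (norm A + cmod \<mu>) * norm x"
proof -
  have "norm (shift A \<mu> x) \<le> norm (A x) + norm (\<mu> *\<^sub>C x)"
    unfolding shift_def by (rule norm_triangle_ineq4)
  also have "\<dots> \<le> norm A * norm x + cmod \<mu> * norm x"
    by (simp add: norm_scaleC norm_blinfun)
  finally show ?thesis
    by (simp add: distrib_right)
qed

lemma cinner_shift: "cinner (shift A \<mu> x) y = cinner x (shift A (cnj \<mu>) y)"
proof -
  have "cinner (A x + (- \<mu>) *\<^sub>C x) y = cinner x (A y + (- cnj \<mu>) *\<^sub>C y)"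
    using sa
    by (simp add: self_adjoint_def is_adjoint_def cinner_add_left cinner_add_right
        cinner_scaleC_left cinner_scaleC_right del: complex_vector.scale_minus_left)
  then show ?thesis
    by (simp add: shift_def)
qed

text \<open>Normality: \<open>S\<^sup>* S = S S\<^sup>*\<close> gives both vectors the same inner
  square. Injectivity thus passes from a shift to its adjoint.\<close>

lemma norm_shift_cnj: "norm (shift A (cnj \<mu>) x) = norm (shift A \<mu> x)"
proof -
  have "cinner (shift A (cnj \<mu>) x) (shift A (cnj \<mu>) x) = cinner (shift A \<mu> x) (shift A \<mu> x)"
    by (simp add: cinner_shift shift_shift)
  then show ?thesis
    by (simp add: norm_eq_sqrt_cinner)
qed

text \<open>
  With \<open>S = A - \<mu>\<close>, the map \<open>x \<mapsto> x - a (S\<^sup>* S x - S\<^sup>* y)\<close> is a contraction for small \<open>a > 0\<close>; a fixed point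
  satisfies \<open>S\<^sup>*(S x - y) = 0\<close>, and \<open>S\<^sup>*\<close> is injective on \<open>V\<close> because \<open>S\<close> is normal.
\<close>

lemma shift_surj:
  assumes c: "0 < c" and below: "\<And>x. x \<in> V \<Longrightarrow> c * norm x \<le> norm (shift A \<mu> x)"
    and y: "y \<in> V"
  shows "\<exists>x\<in>V. shift A \<mu> x = y"
proof -
  \<comment> \<open>\<open>K\<close> dominates the operator norm of both shifts as well as
    \<open>c\<close>; hence \<open>a * c\<^sup>2 \<le> 1\<close>, and the root in \<open>q\<close>
    is taken of a nonnegative number.\<close>
  define K where "K = norm A + cmod \<mu> + c"
  define a where "a = 1 / K\<^sup>2"
  define q where "q = sqrt (1 - a * c\<^sup>2)"
  let ?S = "shift A \<mu>" and ?R = "shift A (cnj \<mu>)"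
  define f where "f x = x - a *\<^sub>R (?R (?S x) - ?R y)" for x
  have K: "0 < K" "c \<le> K"
    using c by (auto simp: K_def add_nonneg_pos)
  have a: "0 < a" "a * K\<^sup>2 = 1"
    using K by (auto simp: a_def)
  have "a * c\<^sup>2 \<le> a * K\<^sup>2"
    using a K c by (intro mult_left_mono power_mono) auto
  then have q: "0 \<le> q" "q < 1" "q\<^sup>2 = 1 - a * c\<^sup>2"
    using a c by (auto simp: q_def)
  have contr: "norm (x - a *\<^sub>R ?R (?S x)) \<le> q * norm x" if x: "x \<in> V" for x
  proof (rule power2_le_imp_le)
    have "norm (?R (?S x)) \<le> (norm A + cmod \<mu>) * norm (?S x)"
      using norm_shift_le[of "cnj \<mu>" "?S x"] by simp
    also have "\<dots> \<le> K * norm (?S x)"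
      using c by (intro mult_right_mono) (auto simp: K_def)
    finally have "(norm (?R (?S x)))\<^sup>2 \<le> K\<^sup>2 * (norm (?S x))\<^sup>2"
      by (metis norm_ge_zero power_mono power_mult_distrib)
    then have "a\<^sup>2 * (norm (?R (?S x)))\<^sup>2 \<le> a\<^sup>2 * (K\<^sup>2 * (norm (?S x))\<^sup>2)"
      by (intro mult_left_mono) auto
    also have "\<dots> = a * (a * K\<^sup>2) * (norm (?S x))\<^sup>2"
      by (simp add: power2_eq_square)
    finally have 1: "a\<^sup>2 * (norm (?R (?S x)))\<^sup>2 \<le> a * (norm (?S x))\<^sup>2"
      by (simp add: a)
    have "(c * norm x)\<^sup>2 \<le> (norm (?S x))\<^sup>2"
      using below[OF x] c by (intro power_mono) auto
    then have 2: "a * (c\<^sup>2 * (norm x)\<^sup>2) \<le> a * (norm (?S x))\<^sup>2"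
      using a by (intro mult_left_mono) (auto simp: power_mult_distrib)
    \<comment> \<open>Half of the cross term \<open>2 * a * (norm (?S x))\<^sup>2\<close> absorbs
      the quadratic term by 1; the other half yields the factor \<open>1 - a * c\<^sup>2\<close> by
      2.\<close>
    have "Re (cinner x (?R (?S x))) = (norm (?S x))\<^sup>2"
      by (simp add: cinner_shift[symmetric] norm_power2_cinner)
    with 1 2 have "(norm (x - a *\<^sub>R ?R (?S x)))\<^sup>2 \<le> (1 - a * c\<^sup>2) * (norm x)\<^sup>2"
      by (simp add: norm_power2_diff_scaleR left_diff_distrib)
    then show "(norm (x - a *\<^sub>R ?R (?S x)))\<^sup>2 \<le> (q * norm x)\<^sup>2"
      by (simp add: q power_mult_distrib)
  qed (use q in simp)
  have "\<exists>!x. x \<in> V \<and> f x = x"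
  proof (rule Banach_fix[OF _ _ q(1,2)])
    show "complete V"
      using closed by (simp add: complete_eq_closed)
    show "V \<noteq> {}"
      using y by auto
    show "f ` V \<subseteq> V"
      using y subspace unfolding f_def
      by (auto intro!: complex_vector.subspace_diff scaleR_in shift_in)
    show "dist (f x) (f z) \<le> q * dist x z" if "x \<in> V" "z \<in> V" for x z
    proof -
      have "f x - f z = (x - z) - a *\<^sub>R ?R (?S (x - z))"
        by (simp add: f_def shift_diff algebra_simps)
      then show ?thesis
        using contr[of "x - z"] that subspace
        by (simp add: dist_norm complex_vector.subspace_diff)
    qed
  qed
  then obtain x where x: "x \<in> V" "f x = x"
    by blast
  then have "?R (?S x - y) = 0"
    using a by (simp add: f_def shift_diff)
  then have "?S (?S x - y) = 0"
    using norm_shift_cnj[of \<mu> "?S x - y"] by simp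
  moreover have "?S x - y \<in> V"
    using x y subspace by (intro complex_vector.subspace_diff shift_in) auto
  ultimately have "c * norm (?S x - y) \<le> 0"
    using below by fastforce
  then have "?S x = y"
    using c by (simp add: mult_le_0_iff)
  with x show ?thesis
    by blast
qed

text \<open>A bounded inverse gives the lower bound. Conversely the lower bound gives injectivity
  and bounds the inverse, while surjectivity comes from \<open>shift_surj\<close>.\<close>

lemma not_spectrum_on_iff:
  "\<mu> \<notin> spectrum_on V A \<longleftrightarrow> (\<exists>c>0. \<forall>x\<in>V. c * norm x \<le> norm (shift A \<mu> x))"
proof
  assume "\<mu> \<notin> spectrum_on V A"
  then obtain G where G: "\<And>x. x \<in> V \<Longrightarrow> G (shift A \<mu> x) = x"
      and "bounded_operator_on V G"
    unfolding spectrum_on_def shift_def by auto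
  then obtain K where K: "\<And>x. x \<in> V \<Longrightarrow> norm (G x) \<le> K * norm x"
    unfolding bounded_operator_on_def by metis
  show "\<exists>c>0. \<forall>x\<in>V. c * norm x \<le> norm (shift A \<mu> x)"
  proof (intro exI conjI ballI)
    \<comment> \<open>Nothing forces \<open>K\<close> to be positive, so
      \<open>\<bar>K\<bar> + 1\<close> takes its place.\<close>
    show pos: "0 < 1 / (\<bar>K\<bar> + 1)"
      by simp
    fix x assume x: "x \<in> V"
    have "norm x \<le> K * norm (shift A \<mu> x)"
      using K[OF shift_in[OF x, of \<mu>]] G[OF x] by simp
    also have "\<dots> \<le> (\<bar>K\<bar> + 1) * norm (shift A \<mu> x)"
      by (intro mult_right_mono) auto
    finally show "1 / (\<bar>K\<bar> + 1) * norm x \<le> norm (shift A \<mu> x)"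
      by (simp add: field_simps add_pos_nonneg)
  qed
next
  let ?S = "shift A \<mu>"
  assume "\<exists>c>0. \<forall>x\<in>V. c * norm x \<le> norm (?S x)"
  then obtain c where c: "0 < c" and below: "\<And>x. x \<in> V \<Longrightarrow> c * norm x \<le> norm (?S x)"
    by blast
  have inj: "x = z" if "x \<in> V" "z \<in> V" "?S x = ?S z" for x z
  proof -
    have "x - z \<in> V"
      using that subspace by (simp add: complex_vector.subspace_diff)
    from below[OF this] have "c * norm (x - z) \<le> 0"
      by (simp add: shift_diff that)
    then show ?thesis
      using c by (simp add: mult_le_0_iff)
  qed
  obtain G where G: "\<And>y. y \<in> V \<Longrightarrow> G y \<in> V" "\<And>y. y \<in> V \<Longrightarrow> ?S (G y) = y"
    using shift_surj[OF c below] by metis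
  have "bounded_operator_on V G"
    unfolding bounded_operator_on_def
  proof (intro conjI ballI allI exI)
    show "G ` V \<subseteq> V"
      using G by auto
    show "G (x + y) = G x + G y" if "x \<in> V" "y \<in> V" for x y
      by (rule inj)
        (use that subspace in \<open>auto simp: G shift_add complex_vector.subspace_add\<close>)
    show "G (k *\<^sub>C x) = k *\<^sub>C G x" if "x \<in> V" for k x
      by (rule inj)
        (use that subspace in \<open>auto simp: G shift_scaleC complex_vector.subspace_scale\<close>)
    show "norm (G x) \<le> 1 / c * norm x" if "x \<in> V" for x
      using below[of "G x"] that c by (simp add: G field_simps)
  qed
  moreover have "G (?S x) = x" "?S (G x) = x" if "x \<in> V" for x
    using that by (auto simp: G shift_in intro: inj[of "G (?S x)" x])
  ultimately show "\<mu> \<notin> spectrum_on V A"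
    unfolding spectrum_on_def shift_def by auto
qed

text \<open>Splitting off the imaginary part of \<open>\<mu>\<close>, Pythagoras bounds the shift
  below by \<open>\<bar>Im \<mu>\<bar>\<close>.\<close>

lemma spectrum_on_real:
  assumes "\<mu> \<in> spectrum_on V A"
  shows "\<mu> = complex_of_real (Re \<mu>)"
proof (rule ccontr)
  assume "\<mu> \<noteq> complex_of_real (Re \<mu>)"
  then have im: "Im \<mu> \<noteq> 0"
    by (simp add: complex_eq_iff)
  have "\<bar>Im \<mu>\<bar> * norm x \<le> norm (shift A \<mu> x)" for x
  proof (rule power2_le_imp_le)
    let ?y = "shift A (complex_of_real (Re \<mu>)) x"
    \<comment> \<open>The shift by the real number \<open>Re \<mu>\<close> is symmetric, so this
      form is real; multiplied by \<open>- \<i> * Im \<mu>\<close> it has real part zero, and the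
      cross term vanishes.\<close>
    have "cnj (cinner ?y x) = cinner ?y x"
      by (subst cinner_commute[symmetric]) (simp add: cinner_shift)
    then have "Im (cinner ?y x) = 0"
      by (simp add: complex_eq_iff)
    then have cross: "Re (cinner ?y ((- \<i> * Im \<mu>) *\<^sub>C x)) = 0"
      by (simp add: cinner_scaleC_right del: complex_vector.scale_minus_left)
    have "shift A \<mu> x = ?y + (- \<i> * Im \<mu>) *\<^sub>C x"
    proof -
      have "\<mu> *\<^sub>C x = (complex_of_real (Re \<mu>) + \<i> * Im \<mu>) *\<^sub>C x"
        by (simp add: complex_eq[symmetric])
      then show ?thesis
        by (simp add: shift_def scaleC_add_left)
    qed
    then have "(norm (shift A \<mu> x))\<^sup>2 = (norm ?y)\<^sup>2 + (norm ((- \<i> * Im \<mu>) *\<^sub>C x))\<^sup>2"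
      using cross by (simp add: norm_power2_add_cinner del: complex_vector.scale_minus_left)
    then show "(\<bar>Im \<mu>\<bar> * norm x)\<^sup>2 \<le> (norm (shift A \<mu> x))\<^sup>2"
      by (simp add: norm_scaleC norm_mult power_mult_distrib)
  qed simp
  with im assms show False
    using not_spectrum_on_iff[of \<mu>] by (meson zero_less_abs_iff)
qed

text \<open>Beyond the norm of \<open>A\<close>, the reverse triangle inequality bounds the shift
  below. Boundedness later provides finite nets of the spectrum.\<close>

lemma spectrum_on_bounded:
  assumes "\<mu> \<in> spectrum_on V A"
  shows "cmod \<mu> \<le> norm A"
proof (rule ccontr)
  assume "\<not> cmod \<mu> \<le> norm A"
  moreover have "(cmod \<mu> - norm A) * norm x \<le> norm (shift A \<mu> x)" for x
  proof -
    have "norm (\<mu> *\<^sub>C x) - norm (A x) \<le> norm (shift A \<mu> x)"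
      unfolding shift_def by (metis norm_minus_commute norm_triangle_ineq2)
    then show ?thesis
      using norm_blinfun[of A x] by (simp add: norm_scaleC left_diff_distrib)
  qed
  ultimately show False
    using assms not_spectrum_on_iff[of \<mu>] by (metis diff_gt_0_iff_gt not_le)
qed

text \<open>
  If \<open>m\<close> is the infimum of \<open>\<parallel>(A - l)x\<parallel>\<close> over unit vectors, then \<open>B = (A - l)\<^sup>2 - m\<^sup>2\<close> is positive
  and its quadratic form has infimum \<open>0\<close>. Positivity gives \<open>\<parallel>Bx\<parallel>\<^sup>2 \<le> L \<langle>Bx, x\<rangle>\<close>, so \<open>B\<close> is not
  bounded below, and one of its factors \<open>A - (l \<plusminus> m)\<close> is not either.
\<close>

lemma spectrum_on_near_approx_eigenvalue:
  fixes l \<delta> :: real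
  assumes approx: "\<And>e. 0 < e \<Longrightarrow> \<exists>x\<in>V. norm (shift A l x) < (\<delta> + e) * norm x"
  shows "\<exists>\<mu>\<in>spectrum_on V A. cmod (l - \<mu>) \<le> \<delta>"
proof -
  let ?S = "shift A l"
  \<comment> \<open>Quotients over non-zero vectors replace norms over unit vectors, so
    \<open>m\<close> is the best lower bound of \<open>?S\<close> on \<open>V\<close>.\<close>
  define N where "N = (\<lambda>x. norm (?S x) / norm x) ` (V - {0})"
  define m where "m = Inf N"
  have N: "\<exists>r\<in>N. r < \<delta> + e" if e: "0 < e" for e
  proof -
    obtain x where x: "x \<in> V" "norm (?S x) < (\<delta> + e) * norm x"
      using approx[OF e] by blast
    then have "x \<noteq> 0"
      by auto
    with x show ?thesis
      by (intro bexI[of _ "norm (?S x) / norm x"]) (auto simp: N_def field_simps)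
  qed
  have bdd: "bdd_below N"
    by (rule bdd_belowI[of _ 0]) (auto simp: N_def)
  have N_ne: "N \<noteq> {}"
    using N[of 1] by auto
  have m0: "0 \<le> m"
    unfolding m_def using N_ne by (rule cInf_greatest) (auto simp: N_def)
  have m\<delta>: "m \<le> \<delta>"
  proof (rule field_le_epsilon)
    fix e :: real assume "0 < e"
    then obtain r where "r \<in> N" "r < \<delta> + e"
      using N by blast
    then show "m \<le> \<delta> + e"
      using cInf_lower[OF _ bdd, of r] by (simp add: m_def)
  qed
  have m_le: "m * norm x \<le> norm (?S x)" if "x \<in> V" for x
  proof (cases "x = 0")
    case False
    then have "m \<le> norm (?S x) / norm x"
      unfolding m_def using that bdd by (intro cInf_lower) (auto simp: N_def)
    then show ?thesis
      using False by (simp add: field_simps)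
  qed simp
  have "l + m \<in> spectrum_on V A \<or> l - m \<in> spectrum_on V A"
  proof (rule ccontr)
    assume "\<not> ?thesis"
    then obtain c1 c2 where c: "c1 > 0" "c2 > 0"
      and c1: "\<And>x. x \<in> V \<Longrightarrow> c1 * norm x \<le> norm (shift A (l + m) x)"
      and c2: "\<And>x. x \<in> V \<Longrightarrow> c2 * norm x \<le> norm (shift A (l - m) x)"
      by (auto simp: not_spectrum_on_iff)
    define B where "B x = ?S (?S x) - m\<^sup>2 *\<^sub>R x" for x
    have B_eq: "B x = shift A (l + m) (shift A (l - m) x)" for x
    proof -
      have shifts: "shift A (l + m) y = ?S y - m *\<^sub>R y" "shift A (l - m) y = ?S y + m *\<^sub>R y" for y
        by (auto simp: shift_def scaleR_scaleC scaleC_add_left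
            complex_vector.scale_left_diff_distrib)
      then show ?thesis
        unfolding shifts by (simp add: B_def shift_add shift_scaleR power2_eq_square algebra_simps)
    qed
    have B_in: "B x \<in> V" if "x \<in> V" for x
      using that by (simp add: B_eq shift_in)
    have B_below: "c1 * c2 * norm x \<le> norm (B x)" if "x \<in> V" for x
    proof -
      have "c1 * c2 * norm x \<le> c1 * norm (shift A (l - m) x)"
        using c c2[OF that] by simp
      also have "\<dots> \<le> norm (B x)"
        using c1[OF shift_in[OF that]] by (simp add: B_eq)
      finally show ?thesis .
    qed
    \<comment> \<open>Since \<open>l\<close> is real, this is the quadratic form
      \<open>cinner (B x) x\<close>.\<close>
    define Q where "Q x = (norm (?S x))\<^sup>2 - m\<^sup>2 * (norm x)\<^sup>2" for x
    define L where "L = (norm A + \<bar>l\<bar> + 1)\<^sup>2"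
    have L: "L > 0"
      unfolding L_def by (intro zero_less_power add_nonneg_pos) auto
    have Q0: "0 \<le> Q x" if "x \<in> V" for x
      using power_mono[OF m_le[OF that], of 2] m0 by (simp add: Q_def power_mult_distrib)
    have QL: "Q x \<le> L * (norm x)\<^sup>2" for x
    proof -
      have "norm (?S x) \<le> (norm A + \<bar>l\<bar>) * norm x"
        using norm_shift_le[of l x] by simp
      also have "\<dots> \<le> (norm A + \<bar>l\<bar> + 1) * norm x"
        by (intro mult_right_mono) auto
      finally have "(norm (?S x))\<^sup>2 \<le> L * (norm x)\<^sup>2"
        unfolding L_def by (metis norm_ge_zero power_mono power_mult_distrib)
      moreover have "0 \<le> m\<^sup>2 * (norm x)\<^sup>2"
        by simp
      ultimately show ?thesis
        unfolding Q_def by linarith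
    qed
    have BQ: "(norm (B x))\<^sup>2 \<le> L * Q x" if x: "x \<in> V" for x
    proof -
      \<comment> \<open>\<open>0 \<le> Q (x - t *\<^sub>R B x)\<close> is expanded in
        \<open>t\<close>; with \<open>Q (B x)\<close> bounded through \<open>L\<close>, the value
        \<open>1 / L\<close> minimises the resulting quadratic.\<close>
      define t where "t = 1 / L"
      have t: "t > 0" "t * L = 1"
        using L by (auto simp: t_def)
      \<comment> \<open>The polarised form of \<open>Q\<close> at \<open>x\<close> and
        \<open>B x\<close> is the inner square of \<open>B x\<close>.\<close>
      have S_cross: "Re (cinner (?S x) (?S (B x))) - m\<^sup>2 * Re (cinner x (B x)) = (norm (B x))\<^sup>2"
      proof -
        have "cinner (?S x) (?S (B x)) = cinner (?S (?S x)) (B x)"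
          by (simp add: cinner_shift)
        moreover have "?S (?S x) = B x + complex_of_real (m\<^sup>2) *\<^sub>C x"
          by (simp add: B_def scaleR_scaleC)
        ultimately show ?thesis
          by (simp add: cinner_add_left cinner_scaleC_left norm_power2_cinner)
      qed
      have "0 \<le> Q (x - t *\<^sub>R B x)"
        using x subspace by (intro Q0 complex_vector.subspace_diff scaleR_in B_in)
      also have "Q (x - t *\<^sub>R B x) = Q x - 2 * t * (norm (B x))\<^sup>2 + t\<^sup>2 * Q (B x)"
        unfolding Q_def shift_diff shift_scaleR norm_power2_diff_scaleR S_cross[symmetric]
        by (simp add: algebra_simps)
      also have "\<dots> \<le> Q x - 2 * t * (norm (B x))\<^sup>2 + t\<^sup>2 * (L * (norm (B x))\<^sup>2)"
        by (intro add_left_mono mult_left_mono QL) auto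
      also have "t\<^sup>2 * (L * (norm (B x))\<^sup>2) = t * (norm (B x))\<^sup>2"
        using t by (simp add: power2_eq_square)
      finally have "t * (norm (B x))\<^sup>2 \<le> Q x"
        by simp
      then show ?thesis
        using L by (simp add: t_def field_simps)
    qed
    \<comment> \<open>\<open>B_below\<close> and \<open>BQ\<close> combine to
      \<open>d * (norm x)\<^sup>2 \<le> Q x\<close>, which lifts every quotient in \<open>N\<close>
      to at least \<open>sqrt (m\<^sup>2 + d)\<close>, above the infimum \<open>m\<close>.\<close>
    define d where "d = (c1 * c2)\<^sup>2 / L"
    have d: "d > 0"
      using c L by (simp add: d_def)
    have "sqrt (m\<^sup>2 + d) \<le> r" if rN: "r \<in> N" for r
    proof -
      obtain x where x: "x \<in> V" "x \<noteq> 0" and r: "r = norm (?S x) / norm x"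
        using rN by (auto simp: N_def)
      have "(c1 * c2 * norm x)\<^sup>2 \<le> (norm (B x))\<^sup>2"
        using B_below x c by (intro power_mono) auto
      also note BQ[OF x(1)]
      finally have "d * (norm x)\<^sup>2 \<le> Q x"
        using L by (simp add: d_def field_simps)
      then have "m\<^sup>2 + d \<le> r\<^sup>2"
        using x by (simp add: r Q_def field_simps)
      then show ?thesis
        by (intro real_le_lsqrt) (auto simp: r)
    qed
    then have "sqrt (m\<^sup>2 + d) \<le> m"
      unfolding m_def using N_ne by (intro cInf_greatest)
    then have "m\<^sup>2 + d \<le> m\<^sup>2"
      by (rule sqrt_le_D)
    with d show False
      by simp
  qed
  then show ?thesis
  proof
    assume "l + m \<in> spectrum_on V A"
    then show ?thesis
      using m0 m\<delta> by (intro bexI[of _ "complex_of_real (l + m)"]) (simp_all add: norm_minus_commute)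
  next
    assume "l - m \<in> spectrum_on V A"
    then show ?thesis
      using m0 m\<delta> by (intro bexI[of _ "complex_of_real (l - m)"]) simp_all
  qed
qed

text \<open>This negates the lower bound of \<open>not_spectrum_on_iff\<close>; strictness excludes
  the zero vector.\<close>

lemma spectrum_on_approx_eigenvector:
  assumes "\<mu> \<in> spectrum_on V A" "0 < e"
  shows "\<exists>x\<in>V. norm (shift A \<mu> x) < e * norm x"
  using assms not_spectrum_on_iff[of \<mu>] by (meson not_le)

end

section \<open>The spectrum of \<open>T\<close> against the spectra of its compressions\<close>

lemma self_adjoint_on_UNIV:
  assumes "complex_linear T" "self_adjoint (T :: 'a::complex_hilbert \<Rightarrow>\<^sub>L 'a)"
  shows "self_adjoint_on UNIV T"
  using assms by unfold_locales (auto intro: complex_vector.subspace_UNIV)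

lemma self_adjoint_on_compression:
  fixes T :: "'a::complex_hilbert \<Rightarrow>\<^sub>L 'a"
  assumes "complex_linear T" "self_adjoint T" and P: "orthogonal_projection P"
  shows "self_adjoint_on (range (blinfun_apply P)) (P o\<^sub>L T o\<^sub>L P)"
proof
  show "complex_linear (P o\<^sub>L T o\<^sub>L P)"
    using assms by (simp add: complex_linear_def orthogonal_projection_def)
  show "self_adjoint (P o\<^sub>L T o\<^sub>L P)"
    using assms by (simp add: self_adjoint_def is_adjoint_def orthogonal_projection_def)
  show "(P o\<^sub>L T o\<^sub>L P) x \<in> range (blinfun_apply P)" for x
    by simp
  show "closed (range (blinfun_apply P))"
    unfolding orthogonal_projection_range[OF P]
    by (intro closed_Collect_eq continuous_intros)
  show "complex_vector.subspace (range (blinfun_apply P))"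
    unfolding orthogonal_projection_range[OF P] using P
    by (intro complex_vector.subspaceI)
      (auto simp: blinfun.add_right orthogonal_projection_def complex_linear_def)
qed

text \<open>The error \<open>e\<close> of the approximate eigenvector is arbitrary, and
  \<open>spectrum_on_near_approx_eigenvalue\<close> tolerates it, so the commutator norm appears
  without loss.\<close>

lemma compression_spectrum_subset_within:
  fixes T :: "'a::complex_hilbert \<Rightarrow>\<^sub>L 'a"
  assumes T: "complex_linear T" "self_adjoint T" and P: "orthogonal_projection P"
  shows "subset_within (norm (commutator T P)) (compression_spectrum P T) (spectrum T)"
  unfolding subset_within_def
proof
  let ?V = "range (blinfun_apply P)" and ?C = "P o\<^sub>L T o\<^sub>L P"
  interpret T: self_adjoint_on UNIV T
    by (rule self_adjoint_on_UNIV[OF T])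
  interpret C: self_adjoint_on ?V ?C
    by (rule self_adjoint_on_compression[OF T P])
  fix \<sigma> assume "\<sigma> \<in> compression_spectrum P T"
  then have \<sigma>: "\<sigma> \<in> spectrum_on ?V ?C"
    by (simp add: compression_spectrum_def)
  \<comment> \<open>That lemma takes a real centre; \<open>\<sigma>\<close> is real, hence equal to
    \<open>Re \<sigma>\<close>.\<close>
  have "\<exists>\<mu>\<in>spectrum_on UNIV T. cmod (Re \<sigma> - \<mu>) \<le> norm (commutator T P)"
  proof (rule T.spectrum_on_near_approx_eigenvalue)
    fix e :: real assume "0 < e"
    then obtain x where x: "x \<in> ?V" "norm (shift ?C \<sigma> x) < e * norm x"
      using C.spectrum_on_approx_eigenvector[OF \<sigma>] by blast
    then have Px: "P x = x"
      using orthogonal_projection_range[OF P] by auto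
    have "shift T \<sigma> x = shift ?C \<sigma> x + commutator T P x"
      by (simp add: shift_def commutator_def blinfun.diff_left Px)
    then have "norm (shift T \<sigma> x) \<le> norm (shift ?C \<sigma> x) + norm (commutator T P x)"
      by (simp add: norm_triangle_ineq)
    also have "\<dots> < (norm (commutator T P) + e) * norm x"
      using x(2) norm_blinfun[of "commutator T P" x] by (simp add: distrib_right)
    finally show "\<exists>x\<in>UNIV. norm (shift T (Re \<sigma>) x) < (norm (commutator T P) + e) * norm x"
      using C.spectrum_on_real[OF \<sigma>] by auto
  qed
  then show "\<exists>\<mu>\<in>spectrum T. cmod (\<sigma> - \<mu>) \<le> norm (commutator T P)"
    using C.spectrum_on_real[OF \<sigma>] by (auto simp: spectrum_def)
qed

text \<open>The threshold for \<open>n\<close> depends on \<open>\<mu>\<close>, through the chosen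
  approximate eigenvector; a finite net removes this dependence later.\<close>

lemma eventually_compression_spectrum_near:
  fixes T :: "'a::complex_hilbert \<Rightarrow>\<^sub>L 'a"
  assumes T: "complex_linear T" "self_adjoint T"
    and P: "\<And>n. orthogonal_projection (P n)" and lim: "\<And>v. (\<lambda>n. P n v) \<longlonglongrightarrow> v"
    and \<mu>: "\<mu> \<in> spectrum T" and e: "0 < e"
  shows "\<forall>\<^sub>F n in sequentially. \<exists>\<sigma>\<in>compression_spectrum (P n) T. cmod (\<mu> - \<sigma>) \<le> e"
proof -
  interpret T: self_adjoint_on UNIV T
    by (rule self_adjoint_on_UNIV[OF T])
  have \<mu>': "\<mu> \<in> spectrum_on UNIV T"
    using \<mu> by (simp add: spectrum_def)
  obtain x where x: "norm (shift T \<mu> x) < e * norm x"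
    using T.spectrum_on_approx_eigenvector[OF \<mu>' e] by blast
  have "bounded_linear (shift T \<mu>)"
    by (rule bounded_linear_intro[where K = "norm T + cmod \<mu>"])
      (use T.norm_shift_le in \<open>auto simp: T.shift_add T.shift_scaleR mult.commute\<close>)
  then have "(\<lambda>n. shift T \<mu> (P n x)) \<longlonglongrightarrow> shift T \<mu> x"
    by (rule bounded_linear.tendsto) (rule lim)
  then have "(\<lambda>n. e * norm (P n x) - norm (shift T \<mu> (P n x)))
      \<longlonglongrightarrow> e * norm x - norm (shift T \<mu> x)"
    by (intro tendsto_diff tendsto_mult tendsto_const tendsto_norm lim)
  \<comment> \<open>The strict inequality survives in the limit process and also forces
    \<open>P n x\<close> to be non-zero.\<close>
  then have "\<forall>\<^sub>F n in sequentially. 0 < e * norm (P n x) - norm (shift T \<mu> (P n x))"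
    by (rule order_tendstoD) (use x in simp)
  then show ?thesis
  proof (rule eventually_mono)
    fix n assume n: "0 < e * norm (P n x) - norm (shift T \<mu> (P n x))"
    let ?V = "range (blinfun_apply (P n))" and ?C = "P n o\<^sub>L T o\<^sub>L P n"
    interpret C: self_adjoint_on ?V ?C
      by (rule self_adjoint_on_compression[OF T P])
    let ?y = "P n x"
    have PP: "P n ?y = ?y"
      using orthogonal_projection_range[OF P[of n]] by auto
    have "P n (\<mu> *\<^sub>C ?y) = \<mu> *\<^sub>C ?y"
      using P[of n] PP by (simp add: orthogonal_projection_def complex_linear_def)
    \<comment> \<open>On the range of \<open>P n\<close> the compression only applies
      \<open>P n\<close> to the shift of \<open>T\<close>, which does not increase norms.\<close>
    then have "shift ?C \<mu> ?y = P n (shift T \<mu> ?y)"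
      by (simp add: shift_def blinfun.diff_right PP)
    then have y: "norm (shift ?C \<mu> ?y) < e * norm ?y"
      using orthogonal_projection_norm_le[OF P[of n], of "shift T \<mu> ?y"] n by simp
    have "\<exists>\<sigma>\<in>spectrum_on ?V ?C. cmod (Re \<mu> - \<sigma>) \<le> e"
    proof (rule C.spectrum_on_near_approx_eigenvalue)
      fix d :: real assume "0 < d"
      then have "e * norm ?y \<le> (e + d) * norm ?y"
        by (intro mult_right_mono) auto
      with y show "\<exists>z\<in>?V. norm (shift ?C (Re \<mu>) z) < (e + d) * norm z"
        using T.spectrum_on_real[OF \<mu>'] by (intro bexI[of _ ?y]) auto
    qed
    then show "\<exists>\<sigma>\<in>compression_spectrum (P n) T. cmod (\<mu> - \<sigma>) \<le> e"
      using T.spectrum_on_real[OF \<mu>'] by (auto simp: compression_spectrum_def)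
  qed
qed

section \<open>Finite nets, Hausdorff distance and convergence of the spectra\<close>

lemma bounded_finite_net:
  fixes S :: "'a::heine_borel set"
  assumes "bounded S" "0 < e"
  obtains F where "finite F" "F \<subseteq> S" "\<And>x. x \<in> S \<Longrightarrow> \<exists>y\<in>F. dist x y < e"
proof -
  \<comment> \<open>Balls centred in \<open>S\<close> itself already cover the compact closure, so
    the net can be chosen inside \<open>S\<close>.\<close>
  have "closure S \<subseteq> (\<Union>y\<in>S. ball y e)"
    using assms(2) by (auto simp: closure_approachable)
  then obtain F where F: "F \<subseteq> S" "finite F" "closure S \<subseteq> (\<Union>y\<in>F. ball y e)"
    using assms(1) compactE_image[of "closure S" S "\<lambda>y. ball y e"]
    by (metis compact_closure open_ball)
  have "\<exists>y\<in>F. dist x y < e" if "x \<in> S" for x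
    using F(3) closure_subset that by (force simp: dist_commute)
  with F show ?thesis
    using that by blast
qed

lemma hausdorff_distance_le:
  assumes "subset_within e S L" "subset_within e L S"
  shows "hausdorff_distance S L \<le> ennreal e"
proof -
  have "(SUP \<sigma>\<in>S. INF \<mu>\<in>L. ennreal (cmod (\<sigma> - \<mu>))) \<le> ennreal e"
    if within: "subset_within e S L" for S L
  proof (rule SUP_least)
    fix \<sigma> assume "\<sigma> \<in> S"
    then obtain \<mu> where "\<mu> \<in> L" "cmod (\<sigma> - \<mu>) \<le> e"
      using within by (auto simp: subset_within_def)
    then show "(INF \<mu>\<in>L. ennreal (cmod (\<sigma> - \<mu>))) \<le> ennreal e"
      by (intro INF_lower2[of \<mu>] ennreal_leI)
  qed
  with assms show ?thesis
    by (simp add: hausdorff_distance_def)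
qed

theorem proposition5p3:
  fixes T :: "'a::complex_hilbert \<Rightarrow>\<^sub>L 'a"
    and P :: "nat \<Rightarrow> 'a \<Rightarrow>\<^sub>L 'a"
  assumes "separable_space (euclidean :: 'a topology)"
    and "complex_linear T"
    and "self_adjoint T"
    and "filtration P"
    and "(\<lambda>n. norm (commutator (P n) T)) \<longlonglongrightarrow> 0"
  shows "((\<lambda>n. hausdorff_distance (compression_spectrum (P n) T) (spectrum T)) \<longlonglongrightarrow> 0) \<and>
    (\<forall>n. subset_within (norm (commutator T (P n))) (compression_spectrum (P n) T) (spectrum T))"
proof
  let ?\<sigma> = "\<lambda>n. compression_spectrum (P n) T"
  have P: "orthogonal_projection (P n)" for n
    using assms(4) by (simp add: filtration_def)
  have lim: "(\<lambda>n. P n v) \<longlonglongrightarrow> v" for v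
    using assms(4) by (simp add: filtration_def tendsto_norm_zero_iff LIM_zero_iff)
  show within: "\<forall>n. subset_within (norm (commutator T (P n))) (?\<sigma> n) (spectrum T)"
    using compression_spectrum_subset_within[OF assms(2,3) P] by blast
  interpret T: self_adjoint_on UNIV T
    by (rule self_adjoint_on_UNIV[OF assms(2,3)])
  have "bounded (spectrum T)"
    unfolding bounded_iff spectrum_def using T.spectrum_on_bounded by blast
  have close: "\<forall>\<^sub>F n in sequentially. hausdorff_distance (?\<sigma> n) (spectrum T) \<le> ennreal e"
    if "0 < e" for e
  proof -
    obtain F where F: "finite F" "F \<subseteq> spectrum T"
        "\<And>\<mu>. \<mu> \<in> spectrum T \<Longrightarrow> \<exists>\<nu>\<in>F. dist \<mu> \<nu> < e / 2"
      using bounded_finite_net[OF \<open>bounded (spectrum T)\<close>, of "e / 2"] \<open>0 < e\<close> by auto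
    \<comment> \<open>Finiteness of \<open>F\<close> gives one threshold for all net points; the
      other \<open>e / 2\<close> pays for moving from \<open>\<mu>\<close> to the net.\<close>
    have "\<forall>\<^sub>F n in sequentially. \<forall>\<nu>\<in>F. \<exists>\<sigma>\<in>?\<sigma> n. cmod (\<nu> - \<sigma>) \<le> e / 2"
      using F \<open>0 < e\<close>
      by (intro eventually_ball_finite ballI
          eventually_compression_spectrum_near[OF assms(2,3) P lim]) auto
    moreover have "\<forall>\<^sub>F n in sequentially. norm (commutator (P n) T) < e"
      using assms(5) \<open>0 < e\<close> by (rule order_tendstoD)
    ultimately show ?thesis
    proof eventually_elim
      case (elim n)
      have "commutator T (P n) = - commutator (P n) T"
        by (simp add: commutator_def)
      then have "norm (commutator T (P n)) < e"
        using elim(2) by simp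
      then have "subset_within e (?\<sigma> n) (spectrum T)"
        using within by (force simp: subset_within_def)
      moreover have "subset_within e (spectrum T) (?\<sigma> n)"
        unfolding subset_within_def
      proof
        fix \<mu> assume "\<mu> \<in> spectrum T"
        then obtain \<nu> where \<nu>: "\<nu> \<in> F" "cmod (\<mu> - \<nu>) < e / 2"
          using F(3) by (auto simp: dist_norm)
        then obtain \<sigma> where "\<sigma> \<in> ?\<sigma> n" "cmod (\<nu> - \<sigma>) \<le> e / 2"
          using elim(1) by blast
        with \<nu> show "\<exists>\<sigma>\<in>?\<sigma> n. cmod (\<mu> - \<sigma>) \<le> e"
          using norm_triangle_ineq[of "\<mu> - \<nu>" "\<nu> - \<sigma>"] by (intro bexI[of _ \<sigma>]) auto
      qed
      ultimately show ?case
        by (rule hausdorff_distance_le)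
    qed
  qed
  show "(\<lambda>n. hausdorff_distance (?\<sigma> n) (spectrum T)) \<longlonglongrightarrow> 0"
  proof (rule order_tendstoI)
    fix a :: ennreal assume "0 < a"
    \<comment> \<open>\<open>a\<close> may be infinite, but \<open>b < a\<close> is finite and so
      comes from a positive real \<open>e\<close>; it also turns the bound by \<open>e\<close> into
      a strict one by \<open>a\<close>.\<close>
    then obtain b where b: "0 < b" "b < a"
      using dense by blast
    then obtain e where e: "b = ennreal e" "0 < e"
      by (cases b) (auto simp: top.not_eq_extremum)
    show "\<forall>\<^sub>F n in sequentially. hausdorff_distance (?\<sigma> n) (spectrum T) < a"
      using close[OF e(2)] by eventually_elim (use b e in auto)
  qed simp
qed

end
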